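(* The operator $\mathcal{L}$ on $\ell^2(\mathcal{P})$ given by the infinite matrix $\mathcal{L}[p,q]=1/\operatorname{lcm}(p,q)$, $p,q\in\mathcal{P}$, is Hilbert--Schmidt, hence compact, and self-adjoint. Its spectral radius satisfies $$\rho(\mathcal{L})=\lambda_\infty .$$ Equivalently, $\sup_{n\ge 1}\rho(\mathcal{L}_n)=\lambda_\infty$, where $\mathcal{L}_n$ denotes the $n\times n$ leading principal submatrix of $\mathcal{L}$.
   Context: $\mathcal{P}=\{p_1<p_2<p_3<\cdots\}=\{2,3,5,7,\ldots\}$ is the set of all prime numbers and $\ell^2(\mathcal{P})$ is the Hilbert space of square-summable sequences indexed by $\mathcal{P}$. The matrix entries are $\mathcal{L}[p,p]=1/p$ and $\mathcal{L}[p,q]=1/(pq)$ for distinct primes $p\ne q$; $\mathcal{L}_n$ is the matrix with entries $1/\operatorname{lcm}(p_i,p_j)$, $1\le i,j\le n$. $\rho(\cdot)$ denotes the spectral radius. The constant $\lambda_\infty$ is the unique solution $x\in\bigl(\tfrac14,+\infty\bigr)$ of $\sum_{p\text{ prime}}\frac{1}{xp^2-p+1}=1$. *)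

theory Defs
  imports
    "HOL-Analysis.Analysis"
    "HOL-Library.Infinite_Set"
    "HOL-Computational_Algebra.Primes"
    "Jordan_Normal_Form.Spectral_Radius"
begin

section \<open>The complex Hilbert space of square-summable families\<close>

typedef 'a ell2 = "{x :: 'a \<Rightarrow> complex. (\<lambda>i. (cmod (x i))\<^sup>2) summable_on UNIV}"
  morphisms ell2_nth Abs_ell2
  by (rule exI[of _ "\<lambda>_. 0"]) simp

setup_lifting type_definition_ell2

lemma summable_on_bound:
  fixes f g :: "'a \<Rightarrow> real"
  assumes "f summable_on A" "\<And>x. x \<in> A \<Longrightarrow> 0 \<le> g x" "\<And>x. x \<in> A \<Longrightarrow> g x \<le> f x"
  shows "g summable_on A"
  by (rule summable_on_comparison_test[of f A g]) (use assms in auto)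

lemma ell2_prod_summable:
  fixes x y :: "'a \<Rightarrow> complex"
  assumes "(\<lambda>i. (cmod (x i))\<^sup>2) summable_on UNIV" "(\<lambda>i. (cmod (y i))\<^sup>2) summable_on UNIV"
  shows "(\<lambda>i. x i * y i) summable_on UNIV"
proof -
  have le: "cmod (x i * y i) \<le> (cmod (x i))\<^sup>2 + (cmod (y i))\<^sup>2" for i
    using sum_squares_bound[of "cmod (x i)" "cmod (y i)"]
      mult_nonneg_nonneg[OF norm_ge_zero norm_ge_zero, of "x i" "y i"]
    unfolding norm_mult by linarith
  have "(\<lambda>i. cmod (x i * y i)) summable_on UNIV"
    by (rule summable_on_bound[OF summable_on_add[OF assms]]) (rule norm_ge_zero le)+
  then show ?thesis by (rule abs_summable_summable)
qed

lemma ell2_add_summable: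
  fixes x y :: "'a \<Rightarrow> complex"
  assumes "(\<lambda>i. (cmod (x i))\<^sup>2) summable_on UNIV" "(\<lambda>i. (cmod (y i))\<^sup>2) summable_on UNIV"
  shows "(\<lambda>i. (cmod (x i + y i))\<^sup>2) summable_on UNIV"
proof -
  have le: "(cmod (x i + y i))\<^sup>2 \<le> 2 * (cmod (x i))\<^sup>2 + 2 * (cmod (y i))\<^sup>2" for i
  proof -
    have "(cmod (x i + y i))\<^sup>2 \<le> (cmod (x i) + cmod (y i))\<^sup>2"
      by (intro power_mono norm_triangle_ineq) auto
    also have "\<dots> \<le> 2 * (cmod (x i))\<^sup>2 + 2 * (cmod (y i))\<^sup>2"
      using sum_squares_bound[of "cmod (x i)" "cmod (y i)"] by (simp add: power2_sum)
    finally show ?thesis .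
  qed
  have "(\<lambda>i. 2 * (cmod (x i))\<^sup>2 + 2 * (cmod (y i))\<^sup>2) summable_on UNIV"
    by (intro summable_on_add summable_on_cmult_right assms)
  then show ?thesis
    by (rule summable_on_bound) (rule zero_le_power2 le)+
qed

lemma ell2_mult_summable:
  fixes x :: "'a \<Rightarrow> complex"
  assumes "(\<lambda>i. (cmod (x i))\<^sup>2) summable_on UNIV"
  shows "(\<lambda>i. (cmod (c * x i))\<^sup>2) summable_on UNIV"
  unfolding norm_mult power_mult_distrib by (intro summable_on_cmult_right assms)

instantiation ell2 :: (type) real_vector
begin

lift_definition zero_ell2 :: "'a ell2" is "\<lambda>_. 0" by simp
lift_definition plus_ell2 :: "'a ell2 \<Rightarrow> 'a ell2 \<Rightarrow> 'a ell2" is "\<lambda>x y i. x i + y i"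
  by (rule ell2_add_summable)
lift_definition uminus_ell2 :: "'a ell2 \<Rightarrow> 'a ell2" is "\<lambda>x i. - x i" by simp
definition minus_ell2 :: "'a ell2 \<Rightarrow> 'a ell2 \<Rightarrow> 'a ell2" where "minus_ell2 x y = x + - y"
lift_definition scaleR_ell2 :: "real \<Rightarrow> 'a ell2 \<Rightarrow> 'a ell2" is "\<lambda>c x i. of_real c * x i"
  by (rule ell2_mult_summable)

instance
  by standard (unfold minus_ell2_def, (transfer, auto simp: algebra_simps)+)

end

lift_definition cscale :: "complex \<Rightarrow> 'a ell2 \<Rightarrow> 'a ell2" (infixr "*\<^sub>c" 75)
  is "\<lambda>c x i. c * x i"
  by (rule ell2_mult_summable)

definition cinner :: "'a ell2 \<Rightarrow> 'a ell2 \<Rightarrow> complex" where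
  "cinner x y = (\<Sum>\<^sub>\<infinity>i. cnj (ell2_nth x i) * ell2_nth y i)"

lemma ell2_nth_summable: "(\<lambda>i. (cmod (ell2_nth x i))\<^sup>2) summable_on UNIV"
  using ell2_nth by auto

lemma cinner_summable: "(\<lambda>i. cnj (ell2_nth x i) * ell2_nth y i) summable_on UNIV"
  using ell2_nth_summable[of x] ell2_nth_summable[of y] by (intro ell2_prod_summable) auto

lemma ell2_eqI: "(\<And>i. ell2_nth x i = ell2_nth y i) \<Longrightarrow> x = y"
  by (simp add: ell2_nth_inject[symmetric] fun_eq_iff)

lemma ell2_nth_diff: "ell2_nth (x - y) i = ell2_nth x i - ell2_nth y i"
  unfolding minus_ell2_def by transfer simp

text \<open>The library has no class of complex inner product spaces, so the real structure, given by
  the real part of the complex inner product, is what carries norm and topology.\<close>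

instantiation ell2 :: (type) real_inner
begin

definition inner_ell2 :: "'a ell2 \<Rightarrow> 'a ell2 \<Rightarrow> real" where
  "inner_ell2 x y = Re (cinner x y)"
definition norm_ell2 :: "'a ell2 \<Rightarrow> real" where
  "norm_ell2 x = sqrt (\<Sum>\<^sub>\<infinity>i. (cmod (ell2_nth x i))\<^sup>2)"
definition sgn_ell2 :: "'a ell2 \<Rightarrow> 'a ell2" where
  "sgn_ell2 x = x /\<^sub>R norm x"
definition dist_ell2 :: "'a ell2 \<Rightarrow> 'a ell2 \<Rightarrow> real" where
  "dist_ell2 x y = norm (x - y)"
definition uniformity_ell2 :: "('a ell2 \<times> 'a ell2) filter" where
  "uniformity_ell2 = (INF e\<in>{0<..}. principal {(x, y). dist x y < e})"
definition open_ell2 :: "'a ell2 set \<Rightarrow> bool" where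
  "open_ell2 U \<longleftrightarrow> (\<forall>x\<in>U. \<forall>\<^sub>F (x', y) in uniformity. x' = x \<longrightarrow> y \<in> U)"

lemma cinner_self: "cinner x x = of_real (\<Sum>\<^sub>\<infinity>i. (cmod (ell2_nth x i))\<^sup>2)"
proof -
  have "cnj z * z = of_real ((cmod z)\<^sup>2)" for z
    using complex_norm_square[of z] by (simp add: mult.commute)
  then show ?thesis
    unfolding cinner_def
    by (simp add: infsumI[OF has_sum_of_real[OF has_sum_infsum[OF ell2_nth_summable]]]
        del: of_real_power)
qed

lemma cinner_commute: "cinner x y = cnj (cinner y x)"
  unfolding cinner_def infsum_cnj[symmetric] by (simp add: mult.commute)

instance
proof
  fix x y z :: "'a ell2" and r :: real
  show "dist x y = norm (x - y)" by (rule dist_ell2_def)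
  show "sgn x = x /\<^sub>R norm x" by (rule sgn_ell2_def)
  show "uniformity = (INF e\<in>{0<..}. principal {(x :: 'a ell2, y). dist x y < e})"
    by (rule uniformity_ell2_def)
  show "open U = (\<forall>x\<in>U. \<forall>\<^sub>F (x', y) in uniformity. x' = x \<longrightarrow> y \<in> U)" for U :: "'a ell2 set"
    by (rule open_ell2_def)
  show "inner x y = inner y x"
    unfolding inner_ell2_def by (subst cinner_commute) simp
  have "cinner (x + y) z = cinner x z + cinner y z"
    unfolding cinner_def infsum_add[OF cinner_summable cinner_summable, symmetric]
    by (simp add: plus_ell2.rep_eq algebra_simps)
  then show "inner (x + y) z = inner x z + inner y z" unfolding inner_ell2_def by simp
  have "cinner (r *\<^sub>R x) y = of_real r * cinner x y"
    unfolding cinner_def by (simp add: scaleR_ell2.rep_eq infsum_cmult_right' mult.assoc)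
  then show "inner (r *\<^sub>R x) y = r * inner x y" unfolding inner_ell2_def by simp
  show "0 \<le> inner x x"
    unfolding inner_ell2_def cinner_self by (simp add: infsum_nonneg)
  show "norm x = sqrt (inner x x)"
    unfolding inner_ell2_def cinner_self norm_ell2_def by simp
  show "(inner x x = 0) = (x = 0)"
  proof
    assume "inner x x = 0"
    then have "(\<Sum>\<^sub>\<infinity>i. (cmod (ell2_nth x i))\<^sup>2) \<le> 0"
      unfolding inner_ell2_def cinner_self by simp
    then have "(cmod (ell2_nth x i))\<^sup>2 = 0" for i
      by (rule nonneg_infsum_le_0D) (auto simp: ell2_nth_summable)
    then show "x = 0" by (intro ell2_eqI) (simp add: zero_ell2.rep_eq)
  next
    assume "x = 0"
    then show "inner x x = 0" unfolding inner_ell2_def cinner_self by (simp add: zero_ell2.rep_eq)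
  qed
qed

end

lemma ell2_finite_sum_le: "finite F \<Longrightarrow> (\<Sum>i\<in>F. (cmod (ell2_nth x i))\<^sup>2) \<le> (norm x)\<^sup>2"
  unfolding norm_ell2_def
  by (simp add: infsum_nonneg finite_sum_le_infsum ell2_nth_summable)

lemma ell2_finite_sums_bound:
  fixes f :: "'a \<Rightarrow> complex"
  assumes "\<And>F. finite F \<Longrightarrow> (\<Sum>i\<in>F. (cmod (f i))\<^sup>2) \<le> B\<^sup>2" and "0 \<le> B"
  shows "\<exists>x. ell2_nth x = f \<and> norm x \<le> B"
proof -
  have s: "(\<lambda>i. (cmod (f i))\<^sup>2) summable_on UNIV"
    by (rule nonneg_bdd_above_summable_on) (use assms in \<open>auto intro!: bdd_aboveI\<close>)
  then have eq: "ell2_nth (Abs_ell2 f) = f" by (simp add: Abs_ell2_inverse)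
  moreover have "norm (Abs_ell2 f) \<le> B"
    unfolding norm_ell2_def eq
    by (rule real_le_lsqrt) (use assms s in \<open>auto intro!: infsum_le_finite_sums infsum_nonneg\<close>)
  ultimately show ?thesis by blast
qed

instance ell2 :: (type) banach
proof
  fix X :: "nat \<Rightarrow> 'a ell2"
  assume C: "Cauchy X"
  have coord: "cmod (ell2_nth x i) \<le> norm x" for x :: "'a ell2" and i
    by (rule power2_le_imp_le) (use ell2_finite_sum_le[of "{i}" x] in simp_all)
  have "Cauchy (\<lambda>n. ell2_nth (X n) i)" for i
    unfolding Cauchy_def dist_norm
  proof (intro allI impI)
    fix e :: real assume "0 < e"
    then obtain M where "\<forall>m\<ge>M. \<forall>n\<ge>M. norm (X m - X n) < e"
      using C unfolding Cauchy_def dist_norm by blast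
    moreover have "cmod (ell2_nth (X m) i - ell2_nth (X n) i) \<le> norm (X m - X n)" for m n
      using coord[of "X m - X n" i] by (simp add: ell2_nth_diff)
    ultimately show "\<exists>M. \<forall>m\<ge>M. \<forall>n\<ge>M. cmod (ell2_nth (X m) i - ell2_nth (X n) i) < e"
      by (meson le_less_trans)
  qed
  then have conv: "convergent (\<lambda>n. ell2_nth (X n) i)" for i
    by (rule Cauchy_convergent)
  define l where "l = (\<lambda>i. lim (\<lambda>n. ell2_nth (X n) i))"
  have l: "(\<lambda>n. ell2_nth (X n) i) \<longlonglongrightarrow> l i" for i
    unfolding l_def by (rule convergent_LIMSEQ_iff[THEN iffD1, OF conv])
  have approx: "\<exists>M. \<forall>m\<ge>M. \<exists>y. ell2_nth y = (\<lambda>i. ell2_nth (X m) i - l i) \<and> norm y \<le> e"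
    if "0 < e" for e :: real
  proof -
    obtain M where M: "\<And>m n. m \<ge> M \<Longrightarrow> n \<ge> M \<Longrightarrow> norm (X m - X n) < e"
      using C \<open>0 < e\<close> unfolding Cauchy_def dist_norm by blast
    have bound: "(\<Sum>i\<in>F. (cmod (ell2_nth (X m) i - l i))\<^sup>2) \<le> e\<^sup>2" if "m \<ge> M" "finite F" for m F
    proof (rule LIMSEQ_le_const2)
      show "(\<lambda>n. \<Sum>i\<in>F. (cmod (ell2_nth (X m) i - ell2_nth (X n) i))\<^sup>2)
              \<longlonglongrightarrow> (\<Sum>i\<in>F. (cmod (ell2_nth (X m) i - l i))\<^sup>2)"
        by (intro tendsto_sum tendsto_power tendsto_norm tendsto_diff tendsto_const l)
      have "(\<Sum>i\<in>F. (cmod (ell2_nth (X m) i - ell2_nth (X n) i))\<^sup>2) \<le> e\<^sup>2" if "n \<ge> M" for n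
      proof -
        have "(\<Sum>i\<in>F. (cmod (ell2_nth (X m) i - ell2_nth (X n) i))\<^sup>2) \<le> (norm (X m - X n))\<^sup>2"
          using ell2_finite_sum_le[OF \<open>finite F\<close>, of "X m - X n"] by (simp add: ell2_nth_diff)
        also have "\<dots> \<le> e\<^sup>2"
          using M[OF \<open>m \<ge> M\<close> \<open>n \<ge> M\<close>] by (intro power_mono) auto
        finally show ?thesis .
      qed
      then show "\<exists>N. \<forall>n\<ge>N. (\<Sum>i\<in>F. (cmod (ell2_nth (X m) i - ell2_nth (X n) i))\<^sup>2) \<le> e\<^sup>2"
        by blast
    qed
    show ?thesis
    proof (intro exI[of _ M] allI impI)
      fix m assume "m \<ge> M"
      show "\<exists>y. ell2_nth y = (\<lambda>i. ell2_nth (X m) i - l i) \<and> norm y \<le> e"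
        by (rule ell2_finite_sums_bound[OF bound less_imp_le[OF \<open>0 < e\<close>]])
          (rule \<open>m \<ge> M\<close>)
    qed
  qed
  obtain m where "\<forall>n\<ge>m. \<exists>y. ell2_nth y = (\<lambda>i. ell2_nth (X n) i - l i) \<and> norm y \<le> 1"
    by (rule exE[OF approx[of 1]]) (simp, rule that)
  then have "\<exists>y. ell2_nth y = (\<lambda>i. ell2_nth (X m) i - l i) \<and> norm y \<le> 1"
    by simp
  then obtain y where y: "ell2_nth y = (\<lambda>i. ell2_nth (X m) i - l i)"
    by (elim exE conjE) (rule that)
  define L where "L = X m - y"
  have L: "ell2_nth L = l" unfolding L_def by (rule ext) (simp add: ell2_nth_diff y)
  have close: "norm (X n - L) \<le> e"
    if ex: "\<exists>y. ell2_nth y = (\<lambda>i. ell2_nth (X n) i - l i) \<and> norm y \<le> e" for n e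
  proof -
    obtain z where z: "ell2_nth z = (\<lambda>i. ell2_nth (X n) i - l i)" and "norm z \<le> e"
      using ex by (elim exE conjE) (rule that)
    have "X n - L = z" by (rule ell2_eqI) (simp add: ell2_nth_diff L z)
    then show ?thesis using \<open>norm z \<le> e\<close> by (rule ssubst)
  qed
  have "X \<longlonglongrightarrow> L"
  proof (rule metric_LIMSEQ_I)
    fix e :: real assume "0 < e"
    then have "0 < e / 2" by simp
    then obtain M where M: "\<forall>m\<ge>M. \<exists>y. ell2_nth y = (\<lambda>i. ell2_nth (X m) i - l i) \<and> norm y \<le> e / 2"
      by (rule exE[OF approx]) (rule that)
    have "dist (X n) L < e" if "n \<ge> M" for n
      using close[OF M[rule_format, OF that]] \<open>0 < e\<close> unfolding dist_norm by linarith
    then show "\<exists>M. \<forall>n\<ge>M. dist (X n) L < e"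
      by (intro exI[of _ M] allI impI)
  qed
  then show "convergent X" by (rule convergentI)
qed


section \<open>Operators\<close>

definition bounded_clinear :: "('a ell2 \<Rightarrow> 'b ell2) \<Rightarrow> bool" where
  "bounded_clinear T \<longleftrightarrow> bounded_linear T \<and> (\<forall>c x. T (c *\<^sub>c x) = c *\<^sub>c T x)"

text \<open>Orthonormal bases in the Hilbert space sense: maximal orthonormal sets.\<close>

definition orthonormal_basis :: "'a ell2 set \<Rightarrow> bool" where
  "orthonormal_basis E \<longleftrightarrow>
     (\<forall>e\<in>E. \<forall>f\<in>E. cinner e f = (if e = f then 1 else 0)) \<and>
     (\<forall>x. (\<forall>e\<in>E. cinner e x = 0) \<longrightarrow> x = 0)"

definition hilbert_schmidt :: "('a ell2 \<Rightarrow> 'a ell2) \<Rightarrow> bool" where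
  "hilbert_schmidt T \<longleftrightarrow> bounded_clinear T \<and>
     (\<exists>E. orthonormal_basis E \<and> (\<lambda>e. (norm (T e))\<^sup>2) summable_on E)"

definition compact_operator :: "('a ell2 \<Rightarrow> 'a ell2) \<Rightarrow> bool" where
  "compact_operator T \<longleftrightarrow> bounded_clinear T \<and> compact (closure (T ` cball 0 1))"

definition self_adjoint :: "('a ell2 \<Rightarrow> 'a ell2) \<Rightarrow> bool" where
  "self_adjoint T \<longleftrightarrow> bounded_clinear T \<and> (\<forall>x y. cinner (T x) y = cinner x (T y))"

definition op_spectrum :: "('a ell2 \<Rightarrow> 'a ell2) \<Rightarrow> complex set" where
  "op_spectrum T = {z. \<not> (\<exists>S. bounded_clinear S \<and>
     (\<forall>x. S (T x - z *\<^sub>c x) = x) \<and> (\<forall>x. T (S x) - z *\<^sub>c S x = x))}"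

text \<open>The spectrum of a bounded operator on a nontrivial space is nonempty and bounded, so the
  real supremum is meaningful.\<close>

definition op_spectral_radius :: "('a ell2 \<Rightarrow> 'a ell2) \<Rightarrow> real" where
  "op_spectral_radius T = (SUP z\<in>op_spectrum T. cmod z)"


section \<open>The reciprocal lcm operator on the primes\<close>

typedef prime_number = "{p :: nat. prime p}"
  morphisms nat_of_prime Abs_prime_number
  using two_is_prime_nat by blast

lemma prime_nat_of_prime: "prime (nat_of_prime p)"
  using nat_of_prime by simp

definition lcm_entry :: "nat \<Rightarrow> nat \<Rightarrow> real" where
  "lcm_entry p q = 1 / real (lcm p q)"

lemma lcm_entry_primes:
  assumes "prime p" "prime q"
  shows "lcm_entry p q = (if p = q then 1 / p else 1 / (real p * real q))"
proof (cases "p = q")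
  case False
  then have "coprime p q" using assms by (simp add: primes_coprime)
  then show ?thesis using False by (simp add: lcm_entry_def lcm_coprime)
qed (simp add: lcm_entry_def)

lemma inverse_primes_summable:
  "(\<lambda>p. (cmod (of_real (1 / real (nat_of_prime p))))\<^sup>2) summable_on UNIV"
proof -
  have "(\<lambda>n::nat. 1 / (real n)\<^sup>2) summable_on UNIV"
    by (rule norm_summable_imp_summable_on) (use inverse_power_summable[of 2, where 'a = real] in \<open>simp add: inverse_eq_divide power_divide\<close>)
  then have "(\<lambda>n. 1 / (real n)\<^sup>2) summable_on range nat_of_prime"
    by (rule summable_on_subset_banach) simp
  then have "((\<lambda>n. 1 / (real n)\<^sup>2) \<circ> nat_of_prime) summable_on UNIV"
    by (subst summable_on_reindex[symmetric]) (auto simp: inj_def nat_of_prime_inject)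
  then show ?thesis by (simp add: o_def norm_divide power_divide)
qed

lemma lcm_row_has_sum:
  fixes x :: "prime_number \<Rightarrow> complex"
  assumes "(\<lambda>q. (cmod (x q))\<^sup>2) summable_on UNIV"
  shows "((\<lambda>q. of_real (lcm_entry (nat_of_prime p) (nat_of_prime q)) * x q) has_sum
     (of_real (1 / nat_of_prime p) * (\<Sum>\<^sub>\<infinity>q. of_real (1 / nat_of_prime q) * x q)
        + of_real (1 / nat_of_prime p - (1 / nat_of_prime p)\<^sup>2) * x p)) UNIV"
proof -
  let ?c = "of_real (1 / nat_of_prime p - (1 / nat_of_prime p)\<^sup>2) * x p"
  have 1: "((\<lambda>q. of_real (1 / nat_of_prime p) * (of_real (1 / nat_of_prime q) * x q)) has_sum
     of_real (1 / nat_of_prime p) * (\<Sum>\<^sub>\<infinity>q. of_real (1 / nat_of_prime q) * x q)) UNIV"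
    by (intro has_sum_cmult_right has_sum_infsum ell2_prod_summable inverse_primes_summable assms)
  have 2: "((\<lambda>q. if q = p then ?c else 0) has_sum ?c) UNIV"
    by (rule has_sum_finite_neutralI[of "{p}"]) auto
  have 3: "of_real (1 / nat_of_prime p) * (of_real (1 / nat_of_prime q) * x q)
             + (if q = p then ?c else 0)
           = of_real (lcm_entry (nat_of_prime p) (nat_of_prime q)) * x q" for q
    by (auto simp: lcm_entry_primes prime_nat_of_prime nat_of_prime_inject algebra_simps
        power2_eq_square)
  show ?thesis using has_sum_add[OF 1 2] unfolding 3 .
qed

lift_definition lcm_op :: "prime_number ell2 \<Rightarrow> prime_number ell2"
  is "\<lambda>x p. \<Sum>\<^sub>\<infinity>q. of_real (lcm_entry (nat_of_prime p) (nat_of_prime q)) * x q"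
proof -
  fix x :: "prime_number \<Rightarrow> complex"
  assume x: "(\<lambda>p. (cmod (x p))\<^sup>2) summable_on UNIV"
  define s where "s = (\<Sum>\<^sub>\<infinity>q. of_real (1 / nat_of_prime q) * x q)"
  have "(\<lambda>p. (cmod (s * of_real (1 / nat_of_prime p)))\<^sup>2) summable_on UNIV"
    by (intro ell2_mult_summable inverse_primes_summable)
  moreover have "(\<lambda>p. (cmod (of_real (1 / nat_of_prime p - (1 / nat_of_prime p)\<^sup>2) * x p))\<^sup>2)
      summable_on UNIV"
  proof (rule summable_on_bound[OF x])
    fix p
    define t where "t = 1 / real (nat_of_prime p)"
    have t: "0 \<le> t" "t \<le> 1"
      using prime_gt_0_nat[OF prime_nat_of_prime[of p]] by (simp_all add: t_def)
    have "t\<^sup>2 \<le> t" using mult_left_le[OF t(2) t(1)] by (simp add: power2_eq_square)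
    with t have "\<bar>t - t\<^sup>2\<bar> \<le> 1" using zero_le_power2[of t] by linarith
    then have "cmod (of_real (t - t\<^sup>2) * x p) \<le> cmod (x p)"
      unfolding norm_mult norm_of_real by (rule mult_left_le_one_le[OF norm_ge_zero abs_ge_zero])
    then show "(cmod (of_real (1 / nat_of_prime p - (1 / nat_of_prime p)\<^sup>2) * x p))\<^sup>2
        \<le> (cmod (x p))\<^sup>2"
      unfolding t_def by (rule power_mono) (rule norm_ge_zero)
  qed simp
  ultimately have "(\<lambda>p. (cmod (s * of_real (1 / nat_of_prime p)
      + of_real (1 / nat_of_prime p - (1 / nat_of_prime p)\<^sup>2) * x p))\<^sup>2) summable_on UNIV"
    by (rule ell2_add_summable)
  then show "(\<lambda>p. (cmod (\<Sum>\<^sub>\<infinity>q. of_real (lcm_entry (nat_of_prime p) (nat_of_prime q)) * x q))\<^sup>2)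
      summable_on UNIV"
    unfolding infsumI[OF lcm_row_has_sum[OF x]] s_def[symmetric] mult.commute[of s] .
qed

lemma lcm_op_has_sum:
  "((\<lambda>q. of_real (lcm_entry (nat_of_prime p) (nat_of_prime q)) * ell2_nth x q)
      has_sum ell2_nth (lcm_op x) p) UNIV"
  unfolding lcm_op.rep_eq
  by (rule has_sum_infsum[OF has_sum_imp_summable[OF lcm_row_has_sum[OF ell2_nth_summable]]])

definition nth_prime :: "nat \<Rightarrow> nat" where
  "nth_prime = enumerate {p. prime p}"

text \<open>\<^const>\<open>nth_prime\<close> counts from zero, as do the indices of \<^const>\<open>mat\<close>. The spectral
  radius of matrices is only available over the complex numbers.\<close>

definition lcm_mat :: "nat \<Rightarrow> complex mat" where
  "lcm_mat n = mat n n (\<lambda>(i, j). of_real (lcm_entry (nth_prime i) (nth_prime j)))"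

lemma lambda_inf_ex1:
  "\<exists>!x :: real. 1 / 4 < x \<and>
     ((\<lambda>p. 1 / (x * (real p)\<^sup>2 - real p + 1)) has_sum 1) {p :: nat. prime p}"
proof -
  define P where "P = {p :: nat. prime p}"
  define g where "g x p = 1 / (x * (real p)\<^sup>2 - real p + 1)" for x and p :: nat
  define F where "F x = infsum (g x) P" for x
  define C where "C = (\<Sum>\<^sub>\<infinity>p\<in>P. 1 / (real p)\<^sup>2)"
  have "(\<lambda>n::nat. 1 / (real n)\<^sup>2) summable_on UNIV"
    by (rule norm_summable_imp_summable_on)
      (use inverse_power_summable[of 2, where 'a = real] in
        \<open>simp add: inverse_eq_divide power_divide\<close>)
  then have sq: "(\<lambda>n::nat. 1 / (real n)\<^sup>2) summable_on P"
    by (rule summable_on_subset_banach) simp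
  have C0: "0 \<le> C" unfolding C_def by (rule infsum_nonneg) simp
  have den: "(x - 1 / 4) * (real p)\<^sup>2 \<le> x * (real p)\<^sup>2 - real p + 1" for x and p :: nat
  proof -
    have "0 \<le> (real p / 2 - 1)\<^sup>2" by simp
    also have "\<dots> = (real p)\<^sup>2 / 4 - real p + 1" by (simp add: power2_eq_square field_simps)
    finally show ?thesis by (simp add: left_diff_distrib)
  qed
  have pos: "0 < (x - 1 / 4) * (real p)\<^sup>2" if "1 / 4 < x" "p \<in> P" for x p
    using that prime_gt_0_nat[of p] unfolding P_def by (intro mult_pos_pos) auto
  have g0: "0 < g x p" if "1 / 4 < x" "p \<in> P" for x p
    using den[where x = x and p = p] pos[OF that] unfolding g_def
    by (intro divide_pos_pos) linarith+
  have g_le: "g x p \<le> 1 / (x - 1 / 4) * (1 / (real p)\<^sup>2)" if "1 / 4 < x" "p \<in> P" for x p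
    using divide_left_mono[OF den[where x = x and p = p], of 1] pos[OF that]
      den[where x = x and p = p] unfolding g_def by simp
  have g_summable: "g x summable_on P" if "1 / 4 < x" for x
    by (rule summable_on_bound[OF summable_on_cmult_right[OF sq, of "1 / (x - 1 / 4)"]])
      (use g0 g_le that in \<open>auto simp del: times_divide_eq_right intro: less_imp_le\<close>)
  have F_le: "F x \<le> 1 / (x - 1 / 4) * C" if "1 / 4 < x" for x
    unfolding F_def C_def infsum_cmult_right'[symmetric]
    by (intro infsum_mono g_summable summable_on_cmult_right sq that g_le)
  have diff: "g x p - g y p = (y - x) * (real p)\<^sup>2 * (g x p * g y p)"
    if "1 / 4 < x" "1 / 4 < y" "p \<in> P" for x y p
  proof -
    have "x * (real p)\<^sup>2 - real p + 1 \<noteq> 0" "y * (real p)\<^sup>2 - real p + 1 \<noteq> 0"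
      using g0[OF that(1,3)] g0[OF that(2,3)] unfolding g_def by auto
    then show ?thesis unfolding g_def by (simp add: field_simps)
  qed
  have two: "2 \<in> P" unfolding P_def by simp
  have strict: "F y < F x" if "1 / 4 < x" "x < y" for x y
  proof -
    have y: "1 / 4 < y" using that by simp
    have le: "g y p \<le> g x p" if p: "p \<in> P" for p
    proof -
      have "0 \<le> (y - x) * (real p)\<^sup>2 * (g x p * g y p)"
        using g0[OF \<open>1 / 4 < x\<close> p] g0[OF y p] \<open>x < y\<close> by (intro mult_nonneg_nonneg) auto
      then show ?thesis using diff[OF \<open>1 / 4 < x\<close> y p] by linarith
    qed
    have "0 < (y - x) * (real 2)\<^sup>2 * (g x 2 * g y 2)"
      using g0[OF \<open>1 / 4 < x\<close> two] g0[OF y two] \<open>x < y\<close> by (intro mult_pos_pos) auto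
    then have lt: "g y 2 < g x 2" using diff[OF \<open>1 / 4 < x\<close> y two] by linarith
    show ?thesis
      unfolding F_def
      by (rule has_sum_strict_mono[OF has_sum_infsum[OF g_summable[OF y]]
            has_sum_infsum[OF g_summable[OF \<open>1 / 4 < x\<close>]] le two lt])
  qed
  have lip: "\<bar>F x - F y\<bar> \<le> 64 * C * \<bar>x - y\<bar>" if x: "3 / 8 \<le> x" and y: "3 / 8 \<le> y" for x y
  proof -
    have x': "1 / 4 < x" and y': "1 / 4 < y" using x y by auto
    have bd: "g z p \<le> 8 * (1 / (real p)\<^sup>2)" if "3 / 8 \<le> z" "p \<in> P" for z p
    proof -
      have "1 / (z - 1 / 4) \<le> 8" using that(1) by (simp add: field_simps)
      then have "1 / (z - 1 / 4) * (1 / (real p)\<^sup>2) \<le> 8 * (1 / (real p)\<^sup>2)"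
        by (rule mult_right_mono) simp
      then show ?thesis using g_le[of z p] that by linarith
    qed
    have le: "norm (g x p - g y p) \<le> (64 * \<bar>x - y\<bar>) * (1 / (real p)\<^sup>2)" if p: "p \<in> P" for p
    proof -
      have "0 < real p" using p prime_gt_0_nat[of p] unfolding P_def by simp
      have "g x p * g y p \<le> (8 * (1 / (real p)\<^sup>2)) * (8 * (1 / (real p)\<^sup>2))"
        using g0[OF x' p] g0[OF y' p] by (intro mult_mono bd x y p) auto
      then have "\<bar>x - y\<bar> * (real p)\<^sup>2 * (g x p * g y p)
          \<le> \<bar>x - y\<bar> * (real p)\<^sup>2 * ((8 * (1 / (real p)\<^sup>2)) * (8 * (1 / (real p)\<^sup>2)))"
        by (rule mult_left_mono) simp
      also have "\<dots> = (64 * \<bar>x - y\<bar>) * (1 / (real p)\<^sup>2)"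
        using \<open>0 < real p\<close> by (simp add: field_simps power2_eq_square)
      finally show ?thesis
        unfolding real_norm_def diff[OF x' y' p] abs_mult abs_of_pos[OF g0[OF x' p]] abs_of_pos[OF g0[OF y' p]]
        by (simp add: abs_minus_commute)
    qed
    have "((\<lambda>p. g x p - g y p) has_sum (F x - F y)) P"
      using has_sum_add[OF has_sum_infsum[OF g_summable[OF x']]
          has_sum_uminusI[OF has_sum_infsum[OF g_summable[OF y']]]]
      unfolding F_def by simp
    moreover have "((\<lambda>p. (64 * \<bar>x - y\<bar>) * (1 / (real p)\<^sup>2)) has_sum (64 * \<bar>x - y\<bar>) * C) P"
      unfolding C_def by (intro has_sum_cmult_right has_sum_infsum sq)
    ultimately have "norm (F x - F y) \<le> (64 * \<bar>x - y\<bar>) * C"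
      by (rule norm_infsum_le) (rule le)
    then show ?thesis by (simp add: mult_ac)
  qed
  define b where "b = 3 / 8 + C"
  have "F b \<le> 1"
  proof -
    have "1 / (b - 1 / 4) * C \<le> 1" using C0 unfolding b_def by (simp add: field_simps)
    then show ?thesis using F_le[of b] C0 unfolding b_def by linarith
  qed
  moreover have "1 \<le> F (3 / 8)"
  proof -
    have "sum (g (3 / 8)) {2} \<le> F (3 / 8)"
      unfolding F_def using two g0
      by (intro finite_sum_le_infsum g_summable) (auto intro: less_imp_le)
    moreover have "g (3 / 8) 2 = 2" unfolding g_def by simp
    ultimately show ?thesis by simp
  qed
  moreover have "continuous_on {3 / 8..b} F"
  proof (rule lipschitz_on_continuous_on)
    show "(64 * C)-lipschitz_on {3 / 8..b} F"
      by (rule lipschitz_onI) (use lip C0 in \<open>auto simp: dist_real_def\<close>)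
  qed
  ultimately obtain x where x: "3 / 8 \<le> x" "F x = 1"
    using IVT2'[of F b 1 "3 / 8"] C0 unfolding b_def by auto
  have "(g z has_sum 1) P \<longleftrightarrow> F z = 1" if "1 / 4 < z" for z
    using g_summable[OF that] unfolding F_def by (metis has_sum_infsum infsumI)
  then have "\<exists>!x. 1 / 4 < x \<and> (g x has_sum 1) P"
  proof (intro ex1I[of _ x])
    fix y assume "1 / 4 < y \<and> (g y has_sum 1) P"
    then have "1 / 4 < y" "F y = 1" unfolding F_def by (auto simp: infsumI)
    then show "y = x" using strict[of x y] strict[of y x] x by (cases x y rule: linorder_cases) auto
  qed (use x in auto)
  then show ?thesis unfolding g_def P_def .
qed

definition lambda_inf :: real where
  "lambda_inf = (THE x. 1 / 4 < x \<and>
     ((\<lambda>p. 1 / (x * (real p)\<^sup>2 - real p + 1)) has_sum 1) {p :: nat. prime p})"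

end

theory Submission
  imports Defs
begin

text \<open>Distinct primes are coprime, so the kernel \<open>1 / lcm p q\<close> on the primes is the rank-one kernel
  \<open>1 / p * (1 / q)\<close> except on the diagonal. With \<open>u = (1 / p)\<close> and the diagonal operator \<open>D\<close> with
  entries \<open>d p = 1 / p - 1 / p\<^sup>2\<close> in \<open>[0, 1 / 4]\<close>, the operator is \<open>x \<mapsto> D x + \<langle>u, x\<rangle> u\<close>. The spectrum
  of such a rank-one perturbation outside that of \<open>D\<close> is governed by the secular equation
  \<open>\<langle>u, (x - D)\<inverse> u\<rangle> = 1\<close>, whose left-hand side is the sum of
  \<open>(1 / p)\<^sup>2 / (x - d p) = 1 / (x * p\<^sup>2 - p + 1)\<close> over all primes. For real \<open>x > 1 / 4\<close> it
  strictly decreases, and \<open>\<lambda>\<close>, short for \<^const>\<open>lambda_inf\<close>, is its root.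

  For the operator, \<open>(\<lambda> - D)\<inverse> u\<close> is an eigenvector with eigenvalue \<open>\<lambda>\<close>
  (\<open>lambda_inf_in_op_spectrum\<close>), and for complex \<open>z\<close> with \<open>\<bar>z\<bar> > \<lambda>\<close> the secular sum has modulus less
  than 1, so the Sherman--Morrison formula (\<open>resolvent_rank_one_perturbation\<close>) provides a bounded
  inverse of the operator minus \<open>z\<close> (\<open>op_spectrum_lcm_op_bound\<close>).

  The finite sections have the same form with partial secular sums. The truncated eigenvector is
  positive and subinvariant for the factor \<open>\<lambda>\<close>, which bounds all their eigenvalues
  (\<open>cmod_eigenvalue_le_of_subinvariant\<close>). Conversely, the roots of the partial secular sums are
  eigenvalues, and they come arbitrarily close to \<open>\<lambda>\<close> (\<open>ex_spectral_radius_lcm_mat_ge\<close>).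

  Compactness holds because the image of the unit ball lies in a Hilbert cube with sides of order
  \<open>1 / p\<close> (\<open>compact_Hilbert_cube\<close>); the Hilbert--Schmidt property is read off from the standard
  basis.\<close>


section \<open>Bounded operators on square-summable families\<close>

lemma ell2_nth_add [simp]: "ell2_nth (x + y) i = ell2_nth x i + ell2_nth y i"
  by (simp add: plus_ell2.rep_eq)

lemma ell2_nth_cscale [simp]: "ell2_nth (c *\<^sub>c x) i = c * ell2_nth x i"
  by (simp add: cscale.rep_eq)

lemma ell2_nth_zero [simp]: "ell2_nth 0 i = 0"
  by (simp add: zero_ell2.rep_eq)

declare ell2_nth_diff [simp]

lemma scaleR_conv_cscale: "r *\<^sub>R x = of_real r *\<^sub>c x" for x :: "'a ell2"
  by (rule ell2_eqI) (simp add: scaleR_ell2.rep_eq)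

lemma norm_cscale [simp]: "norm (c *\<^sub>c x) = cmod c * norm x" for x :: "'a ell2"
  unfolding norm_ell2_def
  by (simp add: norm_mult power_mult_distrib infsum_cmult_right' real_sqrt_mult)

lemma has_sum_cinner: "((\<lambda>i. cnj (ell2_nth x i) * ell2_nth y i) has_sum cinner x y) UNIV"
  unfolding cinner_def by (rule has_sum_infsum[OF cinner_summable])

lemma cinner_add_right: "cinner x (y + z) = cinner x y + cinner x z"
  using has_sum_unique[OF has_sum_cinner[of x "y + z"] has_sum_cong[THEN iffD1, rotated,
        OF has_sum_add[OF has_sum_cinner[of x y] has_sum_cinner[of x z]]]]
  by (simp add: algebra_simps)

lemma cinner_cscale_right: "cinner x (c *\<^sub>c y) = c * cinner x y"
  using has_sum_unique[OF has_sum_cinner[of x "c *\<^sub>c y"] has_sum_cong[THEN iffD1, rotated,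
        OF has_sum_cmult_right[OF has_sum_cinner[of x y], of c]]]
  by (simp add: algebra_simps)

text \<open>The Cauchy--Schwarz inequality of the underlying real inner product only bounds the real
  part of \<^term>\<open>cinner x y\<close>. Rotating \<^term>\<open>y\<close> by the conjugate of \<^term>\<open>cinner x y\<close> makes the
  product real.\<close>

lemma cinner_Cauchy_Schwarz: "cmod (cinner x y) \<le> norm x * norm y"
proof (cases "cinner x y = 0")
  case False
  let ?c = "cinner x y"
  have "(cmod ?c)\<^sup>2 = inner x (cnj ?c *\<^sub>c y)"
    unfolding inner_ell2_def cinner_cscale_right cmod_power2 by (simp add: power2_eq_square)
  also have "\<dots> \<le> norm x * norm (cnj ?c *\<^sub>c y)"
    by (rule norm_cauchy_schwarz)
  finally have "cmod ?c * cmod ?c \<le> cmod ?c * (norm x * norm y)"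
    by (simp add: power2_eq_square mult_ac)
  then show ?thesis
    using False by simp
qed simp

lemma bounded_clinearI:
  assumes "\<And>x y. T (x + y) = T x + T y" "\<And>c x. T (c *\<^sub>c x) = c *\<^sub>c T x"
    and "\<And>x. norm (T x) \<le> K * norm x"
  shows "bounded_clinear T"
  unfolding bounded_clinear_def
  by (intro conjI bounded_linear_intro[where K = K] allI)
    (use assms in \<open>simp_all add: scaleR_conv_cscale mult.commute\<close>)

lemma bounded_clinear_add:
  assumes "bounded_clinear S" "bounded_clinear T"
  shows "bounded_clinear (\<lambda>x. S x + T x)"
  using assms unfolding bounded_clinear_def
  by (auto intro!: bounded_linear_add ell2_eqI simp: algebra_simps)

lemma bounded_clinear_compose:
  assumes "bounded_clinear S" "bounded_clinear T"
  shows "bounded_clinear (\<lambda>x. S (T x))"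
  using assms bounded_linear_compose[of S T] unfolding bounded_clinear_def by simp

lemma bounded_clinear_rank_one: "bounded_clinear (\<lambda>x. cinner a x *\<^sub>c b)"
proof (rule bounded_clinearI[where K = "norm a * norm b"])
  fix x
  show "norm (cinner a x *\<^sub>c b) \<le> norm a * norm b * norm x"
    using mult_right_mono[OF cinner_Cauchy_Schwarz[of a x] norm_ge_zero[of b]]
    by (simp add: mult_ac)
qed (auto intro!: ell2_eqI simp: cinner_add_right cinner_cscale_right algebra_simps)

text \<open>For an unbounded symbol the result may fail to be square-summable; then the value is
  unspecified, so the facts on \<open>diag_op\<close> assume a bound on the symbol.\<close>

definition diag_op :: "('a \<Rightarrow> complex) \<Rightarrow> 'a ell2 \<Rightarrow> 'a ell2" where
  "diag_op d x = Abs_ell2 (\<lambda>i. d i * ell2_nth x i)"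

lemma
  assumes "\<And>i. cmod (d i) \<le> B"
  shows ell2_nth_diag_op: "ell2_nth (diag_op d x) i = d i * ell2_nth x i"
    and norm_diag_op: "norm (diag_op d x) \<le> B * norm x"
proof -
  have B: "0 \<le> B" using assms[of i] norm_ge_zero order_trans by blast
  have "\<exists>y. ell2_nth y = (\<lambda>i. d i * ell2_nth x i) \<and> norm y \<le> B * norm x"
  proof (rule ell2_finite_sums_bound)
    fix F :: "'a set" assume "finite F"
    have "(\<Sum>i\<in>F. (cmod (d i * ell2_nth x i))\<^sup>2) \<le> (\<Sum>i\<in>F. B\<^sup>2 * (cmod (ell2_nth x i))\<^sup>2)"
      unfolding norm_mult power_mult_distrib
      by (intro sum_mono mult_right_mono power_mono assms) auto
    also have "\<dots> \<le> B\<^sup>2 * (norm x)\<^sup>2"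
      unfolding sum_distrib_left[symmetric]
      by (intro mult_left_mono ell2_finite_sum_le \<open>finite F\<close>) auto
    finally show "(\<Sum>i\<in>F. (cmod (d i * ell2_nth x i))\<^sup>2) \<le> (B * norm x)\<^sup>2"
      by (simp add: power_mult_distrib)
  qed (use B in simp)
  then obtain y where y: "ell2_nth y = (\<lambda>i. d i * ell2_nth x i)" "norm y \<le> B * norm x"
    by blast
  moreover have "diag_op d x = y"
    unfolding diag_op_def y(1)[symmetric] by (rule ell2_nth_inverse)
  ultimately show "ell2_nth (diag_op d x) i = d i * ell2_nth x i"
    and "norm (diag_op d x) \<le> B * norm x" by simp_all
qed

lemma bounded_clinear_diag_op:
  assumes "\<And>i. cmod (d i) \<le> B"
  shows "bounded_clinear (diag_op d)"
  by (rule bounded_clinearI[where K = B])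
    (auto intro!: ell2_eqI norm_diag_op assms simp: ell2_nth_diag_op[OF assms] algebra_simps)

definition ell2_unit :: "'a \<Rightarrow> 'a ell2" where
  "ell2_unit i = Abs_ell2 (\<lambda>j. if j = i then 1 else 0)"

lemma ell2_nth_unit: "ell2_nth (ell2_unit i) j = (if j = i then 1 else 0)"
proof -
  have "(\<lambda>j. (cmod (if j = i then 1 else 0))\<^sup>2) summable_on UNIV"
    by (rule has_sum_imp_summable[OF has_sum_finite_neutralI[of "{i}"]]) auto
  then show ?thesis
    unfolding ell2_unit_def by (subst Abs_ell2_inverse) auto
qed

lemma cinner_unit: "cinner (ell2_unit i) x = ell2_nth x i"
  by (rule has_sum_unique[OF has_sum_cinner has_sum_finite_neutralI[of "{i}"]])
    (auto simp: ell2_nth_unit)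

lemma norm_unit: "norm (ell2_unit i) = 1"
  unfolding norm_eq_sqrt_inner inner_ell2_def by (simp add: cinner_unit ell2_nth_unit)

lemma orthonormal_basis_unit: "orthonormal_basis (range ell2_unit)"
  unfolding orthonormal_basis_def
proof (intro conjI ballI allI impI)
  fix e f :: "'a ell2" assume "e \<in> range ell2_unit" "f \<in> range ell2_unit"
  then obtain i j where "e = ell2_unit i" "f = ell2_unit j" by blast
  moreover have "ell2_unit i = ell2_unit j \<longleftrightarrow> i = j"
    using ell2_nth_unit[of i i] ell2_nth_unit[of j i] by (auto split: if_splits)
  ultimately show "cinner e f = (if e = f then 1 else 0)"
    by (simp add: cinner_unit ell2_nth_unit)
qed (auto intro!: ell2_eqI simp: cinner_unit)

lemma hilbert_schmidtI:
  assumes "bounded_clinear T" "(\<lambda>i. (norm (T (ell2_unit i)))\<^sup>2) summable_on UNIV"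
  shows "hilbert_schmidt T"
proof -
  have "inj (ell2_unit :: 'a \<Rightarrow> 'a ell2)"
    by (rule injI) (metis ell2_nth_unit zero_neq_one)
  then have "(\<lambda>e. (norm (T e))\<^sup>2) summable_on range ell2_unit"
    using assms(2) by (subst summable_on_reindex) (auto simp: o_def)
  then show ?thesis
    unfolding hilbert_schmidt_def using assms(1) orthonormal_basis_unit by blast
qed

text \<open>By Tychonoff's theorem, the box of all families dominated by \<^term>\<open>c\<close> is compact in the
  product topology. On this box the tails of the families are uniformly small in square sum, so
  that coordinatewise convergence implies convergence in norm: the embedding into the Hilbert space
  is continuous, and the cube is a continuous image of a compact set.\<close>

lemma compact_Hilbert_cube:
  fixes c :: "'a \<Rightarrow> real"
  assumes c: "(\<lambda>i. (c i)\<^sup>2) summable_on UNIV"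
  shows "compact {x. \<forall>i. cmod (ell2_nth x i) \<le> c i}" (is "compact ?Q")
proof -
  define K where "K = PiE UNIV (\<lambda>i. cball (0::complex) (c i))"
  have K: "f \<in> K \<longleftrightarrow> (\<forall>i. cmod (f i) \<le> c i)" for f
    unfolding K_def by auto
  have "compactin (product_topology (\<lambda>i. euclidean) UNIV) K"
    unfolding K_def compactin_PiE by simp
  then have "compact K"
    unfolding euclidean_product_topology by simp
  have rep: "ell2_nth (Abs_ell2 f) = f" if "f \<in> K" for f
  proof -
    have "(\<lambda>i. (cmod (f i))\<^sup>2) summable_on UNIV"
      by (rule summable_on_bound[OF c]) (use that in \<open>auto simp: K intro!: power_mono\<close>)
    then show ?thesis by (simp add: Abs_ell2_inverse)
  qed
  have "continuous_on K Abs_ell2"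
    unfolding continuous_on_def
  proof (intro ballI tendstoI)
    fix f and e :: real
    assume f: "f \<in> K" and "0 < e"
    \<comment> \<open>The head of the difference contributes \<open>\<epsilon>\<close> and its tail, where coordinates differ by at
      most \<^term>\<open>2 * c i\<close>, contributes \<open>4 * \<epsilon>\<close>; together they stay below \<^term>\<open>(e / 2)\<^sup>2\<close>.\<close>
    define \<epsilon> where "\<epsilon> = e\<^sup>2 / 32"
    have "0 < \<epsilon>" using \<open>0 < e\<close> by (simp add: \<epsilon>_def)
    define S where "S = (\<Sum>\<^sub>\<infinity>i. (c i)\<^sup>2)"
    have S: "((\<lambda>i. (c i)\<^sup>2) has_sum S) UNIV"
      unfolding S_def by (rule has_sum_infsum[OF c])
    have "\<forall>\<^sub>F F in finite_subsets_at_top UNIV. S - \<epsilon> < (\<Sum>i\<in>F. (c i)\<^sup>2)"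
      using S \<open>0 < \<epsilon>\<close> unfolding has_sum_def by (auto intro: order_tendstoD)
    then obtain F where F: "finite F" "S - \<epsilon> < (\<Sum>i\<in>F. (c i)\<^sup>2)"
      unfolding eventually_finite_subsets_at_top by blast
    have tail: "(\<Sum>i\<in>G. (c i)\<^sup>2) \<le> \<epsilon>" if "finite G" "G \<inter> F = {}" for G
    proof -
      have "(\<Sum>i\<in>F \<union> G. (c i)\<^sup>2) \<le> S"
        unfolding S_def by (rule finite_sum_le_infsum[OF c]) (use F that in auto)
      moreover have "(\<Sum>i\<in>F \<union> G. (c i)\<^sup>2) = (\<Sum>i\<in>F. (c i)\<^sup>2) + (\<Sum>i\<in>G. (c i)\<^sup>2)"
        by (rule sum.union_disjoint) (use F that in auto)
      ultimately show ?thesis using F by linarith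
    qed
    have "((\<lambda>g. g i) \<longlongrightarrow> f i) (at f within K)" for i
      using continuous_on_subset[OF continuous_on_product_coordinates[of i], of K] f
      unfolding continuous_on_def by auto
    then have "((\<lambda>g. \<Sum>i\<in>F. (cmod (g i - f i))\<^sup>2) \<longlongrightarrow> (\<Sum>i\<in>F. (cmod (f i - f i))\<^sup>2)) (at f within K)"
      by (intro tendsto_intros)
    then have "\<forall>\<^sub>F g in at f within K. (\<Sum>i\<in>F. (cmod (g i - f i))\<^sup>2) < \<epsilon>"
      using \<open>0 < \<epsilon>\<close> by (intro order_tendstoD(2)) auto
    moreover have "\<forall>\<^sub>F g in at f within K. g \<in> K"
      by (simp add: eventually_at_filter)
    ultimately show "\<forall>\<^sub>F g in at f within K. dist (Abs_ell2 g) (Abs_ell2 f) < e"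
    proof eventually_elim
      case (elim g)
      have "\<exists>y. ell2_nth y = ell2_nth (Abs_ell2 g - Abs_ell2 f) \<and> norm y \<le> e / 2"
      proof (rule ell2_finite_sums_bound)
        fix G :: "'a set" assume G: "finite G"
        have far: "(cmod (g i - f i))\<^sup>2 \<le> 4 * (c i)\<^sup>2" for i
        proof -
          have "cmod (g i - f i) \<le> 2 * c i"
            using norm_triangle_ineq4[of "g i" "f i"] f elim(2) unfolding K by (smt (verit))
          then have "(cmod (g i - f i))\<^sup>2 \<le> (2 * c i)\<^sup>2" by (intro power_mono) auto
          then show ?thesis by simp
        qed
        have "(\<Sum>i\<in>G. (cmod (g i - f i))\<^sup>2)
            = (\<Sum>i\<in>G \<inter> F. (cmod (g i - f i))\<^sup>2) + (\<Sum>i\<in>G - F. (cmod (g i - f i))\<^sup>2)"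
          by (rule sum.Int_Diff[OF G])
        also have "\<dots> \<le> (\<Sum>i\<in>F. (cmod (g i - f i))\<^sup>2) + (\<Sum>i\<in>G - F. 4 * (c i)\<^sup>2)"
          by (intro add_mono sum_mono2 sum_mono far) (use F in auto)
        also have "\<dots> \<le> \<epsilon> + 4 * \<epsilon>"
          unfolding sum_distrib_left[symmetric]
          using elim(1) tail[of "G - F"] G by (intro add_mono mult_left_mono) auto
        also have "\<dots> \<le> (e / 2)\<^sup>2"
          by (simp add: \<epsilon>_def power_divide)
        finally show "(\<Sum>i\<in>G. (cmod (ell2_nth (Abs_ell2 g - Abs_ell2 f) i))\<^sup>2) \<le> (e / 2)\<^sup>2"
          by (simp add: rep f elim(2))
      qed (use \<open>0 < e\<close> in simp)
      then have "norm (Abs_ell2 g - Abs_ell2 f) \<le> e / 2"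
        by (metis ell2_nth_inject)
      then show ?case using \<open>0 < e\<close> by (simp add: dist_norm)
    qed
  qed
  then have "compact (Abs_ell2 ` K)"
    using \<open>compact K\<close> by (rule compact_continuous_image)
  also have "Abs_ell2 ` K = ?Q"
  proof (rule equalityI)
    show "?Q \<subseteq> Abs_ell2 ` K"
    proof
      fix x assume "x \<in> ?Q"
      then have "ell2_nth x \<in> K" by (simp add: K)
      then show "x \<in> Abs_ell2 ` K" by (metis ell2_nth_inverse imageI)
    qed
  qed (use K in \<open>auto simp: rep\<close>)
  finally show ?thesis .
qed

lemma compact_operatorI:
  assumes T: "bounded_clinear T" and c: "(\<lambda>i. (c i)\<^sup>2) summable_on UNIV"
    and bound: "\<And>x i. norm x \<le> 1 \<Longrightarrow> cmod (ell2_nth (T x) i) \<le> c i"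
  shows "compact_operator T"
proof -
  let ?Q = "{x. \<forall>i. cmod (ell2_nth x i) \<le> c i}"
  have Q: "compact ?Q" by (rule compact_Hilbert_cube[OF c])
  have "T ` cball 0 1 \<subseteq> ?Q"
    using bound by auto
  then have "closure (T ` cball 0 1) \<subseteq> ?Q"
    by (rule closure_minimal[OF _ compact_imp_closed[OF Q]])
  then have "?Q \<inter> closure (T ` cball 0 1) = closure (T ` cball 0 1)"
    by (rule Int_absorb1)
  moreover have "compact (?Q \<inter> closure (T ` cball 0 1))"
    by (rule compact_Int_closed[OF Q closed_closure])
  ultimately have "compact (closure (T ` cball 0 1))"
    by (rule subst)
  then show ?thesis
    unfolding compact_operator_def using T by blast
qed

lemma eigenvalue_in_op_spectrum:
  assumes "T v = z *\<^sub>c v" "v \<noteq> 0"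
  shows "z \<in> op_spectrum T"
proof -
  have False if S: "bounded_clinear S" "\<And>x. S (T x - z *\<^sub>c x) = x" for S
  proof -
    have "S 0 = 0"
      using S(1) unfolding bounded_clinear_def by (auto intro: linear_simps)
    then show False using S(2)[of v] assms by simp
  qed
  then show ?thesis unfolding op_spectrum_def by blast
qed

section \<open>Rank-one perturbations of diagonal operators\<close>

text \<open>The Sherman--Morrison formula. Write \<open>R\<close> for the resolvent of the diagonal part at
  \<^term>\<open>z\<close>. Applying \<open>R\<close> to \<open>(T - z) x = y\<close> gives \<open>x + \<langle>u, x\<rangle> w = R y\<close> with \<open>w = R u\<close>, and
  pairing with \<open>u\<close> gives \<open>\<langle>u, x\<rangle> = \<langle>u, R y\<rangle> / (1 + \<langle>u, w\<rangle>)\<close>. So the rank-one term can destroy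
  invertibility only at the roots of the secular equation \<open>1 + \<langle>u, w\<rangle> = 0\<close>.\<close>

lemma resolvent_rank_one_perturbation:
  assumes T: "\<And>x i. ell2_nth (T x) i = d i * ell2_nth x i + cinner u x * ell2_nth u i"
    and \<delta>: "0 < \<delta>" "\<And>i. \<delta> \<le> cmod (d i - z)"
    and w: "\<And>i. ell2_nth w i = ell2_nth u i / (d i - z)" and nz: "1 + cinner u w \<noteq> 0"
  shows "z \<notin> op_spectrum T"
proof -
  define R where "R = diag_op (\<lambda>i. 1 / (d i - z))"
  define k where "k = 1 + cinner u w"
  define S where "S y = R y + cinner u (R y) *\<^sub>c ((- 1 / k) *\<^sub>c w)" for y
  have k: "k \<noteq> 0" "cinner u w = k - 1" using nz by (simp_all add: k_def)
  have d0: "d i - z \<noteq> 0" for i using \<delta>(1) \<delta>(2)[of i] by auto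
  have bd: "cmod (1 / (d i - z)) \<le> 1 / \<delta>" for i
    using \<delta>(1) \<delta>(2)[of i] by (simp add: norm_divide frac_le)
  have R_nth: "ell2_nth (R y) i = ell2_nth y i / (d i - z)" for y i
    unfolding R_def by (subst ell2_nth_diag_op[where d = "\<lambda>i. 1 / (d i - z)", OF bd]) simp
  have R: "bounded_clinear R"
    unfolding R_def by (rule bounded_clinear_diag_op[OF bd])
  have S_nth: "ell2_nth (S y) i = (ell2_nth y i - cinner u (R y) / k * ell2_nth u i) / (d i - z)"
    for y i
    by (simp add: S_def R_nth w diff_divide_distrib)
  have "bounded_clinear S"
    unfolding S_def
    by (intro bounded_clinear_add R bounded_clinear_compose[OF bounded_clinear_rank_one R])
  moreover have "S (T x - z *\<^sub>c x) = x" for x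
  proof -
    have "R (T x - z *\<^sub>c x) = cinner u x *\<^sub>c w + x"
    proof (rule ell2_eqI)
      fix i
      have "ell2_nth (T x - z *\<^sub>c x) i = cinner u x * ell2_nth u i + (d i - z) * ell2_nth x i"
        by (simp add: T algebra_simps)
      then show "ell2_nth (R (T x - z *\<^sub>c x)) i = ell2_nth (cinner u x *\<^sub>c w + x) i"
        unfolding R_nth using d0[of i] by (simp add: w add_divide_distrib)
    qed
    then have "cinner u (R (T x - z *\<^sub>c x)) = cinner u x * k"
      by (simp add: cinner_add_right cinner_cscale_right k(2) algebra_simps)
    then have "ell2_nth (S (T x - z *\<^sub>c x)) i = ((d i - z) * ell2_nth x i) / (d i - z)" for i
      unfolding S_nth using k(1) by (simp add: T algebra_simps)
    then show ?thesis
      using d0 by (intro ell2_eqI) simp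
  qed
  moreover have "T (S y) - z *\<^sub>c S y = y" for y
  proof (rule ell2_eqI)
    fix i
    have "cinner u (S y) = cinner u (R y) * (1 - (k - 1) / k)"
      unfolding S_def cinner_add_right cinner_cscale_right k(2) by (simp add: algebra_simps)
    also have "1 - (k - 1) / k = 1 / k"
      using k(1) by (simp add: diff_divide_distrib)
    finally have c: "cinner u (S y) = cinner u (R y) / k" by simp
    have "ell2_nth (T (S y) - z *\<^sub>c S y) i
        = (d i - z) * ell2_nth (S y) i + cinner u (S y) * ell2_nth u i"
      by (simp add: T algebra_simps)
    also have "(d i - z) * ell2_nth (S y) i = ell2_nth y i - cinner u (R y) / k * ell2_nth u i"
      unfolding S_nth using d0[of i] by simp
    finally show "ell2_nth (T (S y) - z *\<^sub>c S y) i = ell2_nth y i"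
      unfolding c by simp
  qed
  ultimately show ?thesis unfolding op_spectrum_def by blast
qed


section \<open>The secular equation of the primes\<close>

text \<open>Off the diagonal, \<open>1 / lcm p q\<close> agrees with the rank-one kernel \<open>1 / p * (1 / q)\<close>; this is
  what remains on the diagonal.\<close>

definition prime_diag :: "nat \<Rightarrow> real" where
  "prime_diag p = 1 / real p - (1 / real p)\<^sup>2"

text \<open>The parabola \<open>t - t\<^sup>2\<close> has its maximum \<open>1 / 4\<close> at \<open>t = 1 / 2\<close>, attained here at the prime 2.
  This is the origin of the bound \<open>1 / 4\<close> in the definition of \<^const>\<open>lambda_inf\<close>.\<close>

lemma prime_diag_le_quarter: "prime_diag p \<le> 1 / 4"
  using zero_le_power2[of "1 / real p - 1 / 2"]
  unfolding prime_diag_def by (simp add: power2_diff power_divide)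

lemma prime_diag_le: "prime_diag p \<le> 1 / real p"
  unfolding prime_diag_def by simp

lemma prime_diag_nonneg: "0 \<le> prime_diag p"
proof (cases "p = 0")
  case False
  then have "1 / real p * (1 / real p) \<le> 1 / real p * 1"
    by (intro mult_left_mono) auto
  then show ?thesis
    unfolding prime_diag_def by (simp add: power2_eq_square)
qed (simp add: prime_diag_def)

lemma lcm_entry_eq:
  assumes "prime p" "prime q"
  shows "lcm_entry p q = 1 / real p * (1 / real q) + (if p = q then prime_diag p else 0)"
  using assms by (simp add: lcm_entry_primes prime_diag_def power2_eq_square)

text \<open>The contribution of \<^term>\<open>p\<close> to \<open>\<langle>u, (x - D)\<inverse> u\<rangle>\<close> for \<open>u = (1 / p)\<close> and \<open>D\<close> the diagonal
  operator with entries \<^const>\<open>prime_diag\<close>. Clearing denominators turns it into the summand of the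
  equation that defines \<^const>\<open>lambda_inf\<close>.\<close>

definition secular :: "real \<Rightarrow> nat \<Rightarrow> real" where
  "secular x p = (1 / real p)\<^sup>2 / (x - prime_diag p)"

lemma secular_eq: "0 < p \<Longrightarrow> secular x p = 1 / (x * (real p)\<^sup>2 - real p + 1)"
proof -
  assume "0 < p"
  then have "x - prime_diag p = (x * (real p)\<^sup>2 - real p + 1) / (real p)\<^sup>2"
    unfolding prime_diag_def by (simp add: add_divide_distrib diff_divide_distrib power2_eq_square)
  then show ?thesis
    using \<open>0 < p\<close> unfolding secular_def by (simp add: power_divide)
qed

lemma secular_pos: "1 / 4 < x \<Longrightarrow> 0 < p \<Longrightarrow> 0 < secular x p"
  using prime_diag_le_quarter[of p] unfolding secular_def by simp

lemma secular_strict_antimono: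
  "1 / 4 < x \<Longrightarrow> x < y \<Longrightarrow> 0 < p \<Longrightarrow> secular y p < secular x p"
  using prime_diag_le_quarter[of p] unfolding secular_def
  by (intro divide_strict_left_mono mult_pos_pos) auto

lemma
  shows lambda_inf_gt: "1 / 4 < lambda_inf"
    and has_sum_secular_lambda_inf: "(secular lambda_inf has_sum 1) {p. prime p}"
proof -
  have *: "1 / 4 < lambda_inf \<and>
     ((\<lambda>p. 1 / (lambda_inf * (real p)\<^sup>2 - real p + 1)) has_sum 1) {p :: nat. prime p}"
    unfolding lambda_inf_def by (rule theI'[OF lambda_inf_ex1])
  then show "1 / 4 < lambda_inf" by blast
  show "(secular lambda_inf has_sum 1) {p. prime p}"
    using * by (subst has_sum_cong[OF secular_eq]) (auto intro: prime_gt_0_nat)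
qed

lemma bij_nat_of_prime: "bij_betw nat_of_prime UNIV {p. prime p}"
  unfolding bij_betw_def
  by (metis inj_onI nat_of_prime_inject type_definition.Rep_range type_definition_prime_number)

lemma has_sum_secular_prime_number:
  "((\<lambda>p. secular lambda_inf (nat_of_prime p)) has_sum 1) UNIV"
  using has_sum_secular_lambda_inf by (subst has_sum_reindex_bij_betw[OF bij_nat_of_prime])

lemma nat_of_prime_pos: "0 < nat_of_prime p"
  using prime_gt_0_nat[OF prime_nat_of_prime] .


section \<open>The reciprocal lcm operator\<close>

definition prime_recip :: "prime_number ell2" where
  "prime_recip = Abs_ell2 (\<lambda>p. of_real (1 / real (nat_of_prime p)))"

abbreviation cprime_diag :: "prime_number \<Rightarrow> complex" where
  "cprime_diag p \<equiv> of_real (prime_diag (nat_of_prime p))"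

lemma ell2_nth_prime_recip: "ell2_nth prime_recip p = of_real (1 / real (nat_of_prime p))"
  unfolding prime_recip_def
  by (subst Abs_ell2_inverse) (use inverse_primes_summable in simp_all)

lemma cmod_cprime_diag: "cmod (cprime_diag p) \<le> 1 / 4"
  unfolding norm_of_real abs_of_nonneg[OF prime_diag_nonneg] by (rule prime_diag_le_quarter)

lemma ell2_nth_lcm_op:
  "ell2_nth (lcm_op x) p = cprime_diag p * ell2_nth x p + cinner prime_recip x * ell2_nth prime_recip p"
  using has_sum_unique[OF lcm_op_has_sum[of p x] lcm_row_has_sum[OF ell2_nth_summable]]
  by (simp add: cinner_def ell2_nth_prime_recip prime_diag_def algebra_simps)

lemma lcm_op_eq: "lcm_op x = diag_op cprime_diag x + cinner prime_recip x *\<^sub>c prime_recip"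
  by (rule ell2_eqI) (simp add: ell2_nth_lcm_op ell2_nth_diag_op[OF cmod_cprime_diag])

lemma bounded_clinear_lcm_op: "bounded_clinear lcm_op"
  unfolding lcm_op_eq[abs_def]
  by (intro bounded_clinear_add bounded_clinear_rank_one bounded_clinear_diag_op[OF cmod_cprime_diag])

lemma self_adjoint_lcm_op: "self_adjoint lcm_op"
  unfolding self_adjoint_def
proof (intro conjI allI bounded_clinear_lcm_op)
  fix x y
  have right: "cinner a (lcm_op b)
      = cinner a (diag_op cprime_diag b) + cinner prime_recip b * cinner a prime_recip" for a b
    by (simp add: lcm_op_eq cinner_add_right cinner_cscale_right)
  have diag: "cinner (diag_op cprime_diag x) y = cinner x (diag_op cprime_diag y)"
    unfolding cinner_def by (simp add: ell2_nth_diag_op[OF cmod_cprime_diag] mult_ac)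
  have "cinner (lcm_op x) y = cnj (cinner y (lcm_op x))"
    by (rule cinner_commute)
  also have "\<dots> = cinner (diag_op cprime_diag x) y + cinner x prime_recip * cinner prime_recip y"
    unfolding right by (simp add: cinner_commute[symmetric])
  also have "\<dots> = cinner x (lcm_op y)"
    unfolding right diag by (simp add: mult.commute)
  finally show "cinner (lcm_op x) y = cinner x (lcm_op y)" .
qed

text \<open>Both the diagonal and the rank-one part shrink the coordinate at \<open>p\<close> by a factor of
  order \<open>1 / p\<close>. Since \<open>1 / p\<close> is square-summable, the image of the unit ball lies in a
  Hilbert cube, which gives compactness.\<close>

lemma lcm_op_coordinate_bound:
  "cmod (ell2_nth (lcm_op x) p) \<le> (1 + norm prime_recip) / real (nat_of_prime p) * norm x"
proof -
  let ?p = "real (nat_of_prime p)"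
  have "cmod (ell2_nth (lcm_op x) p)
      \<le> prime_diag (nat_of_prime p) * cmod (ell2_nth x p) + cmod (cinner prime_recip x) * (1 / ?p)"
    unfolding ell2_nth_lcm_op ell2_nth_prime_recip
    by (rule order_trans[OF norm_triangle_ineq]) (simp add: norm_mult prime_diag_nonneg norm_divide)
  also have "\<dots> \<le> 1 / ?p * norm x + (norm prime_recip * norm x) * (1 / ?p)"
  proof (intro add_mono mult_mono prime_diag_le cinner_Cauchy_Schwarz)
    show "cmod (ell2_nth x p) \<le> norm x"
      by (rule power2_le_imp_le) (use ell2_finite_sum_le[of "{p}" x] in simp_all)
  qed auto
  also have "\<dots> = (1 + norm prime_recip) / ?p * norm x"
    by (simp add: add_divide_distrib algebra_simps)
  finally show ?thesis .
qed

lemma summable_lcm_op_bound: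
  "(\<lambda>p. ((1 + norm prime_recip) / real (nat_of_prime p))\<^sup>2) summable_on UNIV"
  using summable_on_cmult_right[OF inverse_primes_summable, of "(1 + norm prime_recip)\<^sup>2"]
  by (simp add: power_divide norm_divide)

lemma compact_operator_lcm_op: "compact_operator lcm_op"
proof (rule compact_operatorI[OF bounded_clinear_lcm_op summable_lcm_op_bound])
  fix x :: "prime_number ell2" and p
  assume "norm x \<le> 1"
  then have "(1 + norm prime_recip) / real (nat_of_prime p) * norm x
      \<le> (1 + norm prime_recip) / real (nat_of_prime p) * 1"
    by (intro mult_left_mono) auto
  then show "cmod (ell2_nth (lcm_op x) p) \<le> (1 + norm prime_recip) / real (nat_of_prime p)"
    using lcm_op_coordinate_bound[of x p] by linarith
qed

text \<open>The image of the unit vector at \<open>p\<close> has norm of order \<open>1 / p\<close> as well: the diagonal part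
  only rescales it, and the rank-one part has the coefficient \<open>1 / p\<close>.\<close>

lemma hilbert_schmidt_lcm_op: "hilbert_schmidt lcm_op"
proof (rule hilbert_schmidtI[OF bounded_clinear_lcm_op])
  have "norm (lcm_op (ell2_unit p)) \<le> (1 + norm prime_recip) / real (nat_of_prime p)" for p
  proof -
    have "norm (diag_op cprime_diag (ell2_unit p)) = norm (cprime_diag p *\<^sub>c ell2_unit p)"
      by (rule arg_cong[where f = norm], rule ell2_eqI)
        (simp add: ell2_nth_diag_op[OF cmod_cprime_diag] ell2_nth_unit)
    also have "\<dots> \<le> 1 / real (nat_of_prime p)"
      by (simp add: norm_unit prime_diag_nonneg prime_diag_le)
    finally have "norm (diag_op cprime_diag (ell2_unit p)) \<le> 1 / real (nat_of_prime p)" .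
    moreover have "cinner prime_recip (ell2_unit p) = of_real (1 / real (nat_of_prime p))"
      by (subst cinner_commute) (simp add: cinner_unit ell2_nth_prime_recip)
    then have "norm (cinner prime_recip (ell2_unit p) *\<^sub>c prime_recip)
        = norm prime_recip / real (nat_of_prime p)"
      by (simp add: norm_divide)
    ultimately show ?thesis
      unfolding lcm_op_eq add_divide_distrib by (rule norm_triangle_mono[OF _ eq_refl])
  qed
  then show "(\<lambda>p. (norm (lcm_op (ell2_unit p)))\<^sup>2) summable_on UNIV"
    by (intro summable_on_bound[OF summable_lcm_op_bound] power_mono) auto
qed

text \<open>The vector \<open>v = (\<lambda> - D)\<inverse> u\<close> satisfies \<open>\<langle>u, v\<rangle> = 1\<close> by the equation that defines \<open>\<lambda>\<close>.
  Hence \<open>D v + \<langle>u, v\<rangle> u = D v + u = \<lambda> v\<close>.\<close>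

lemma lambda_inf_in_op_spectrum: "of_real lambda_inf \<in> op_spectrum lcm_op"
proof -
  define \<delta> where "\<delta> p = lambda_inf - prime_diag (nat_of_prime p)" for p
  have \<delta>: "lambda_inf - 1 / 4 \<le> \<delta> p" "0 < \<delta> p" for p
    using prime_diag_le_quarter[of "nat_of_prime p"] lambda_inf_gt unfolding \<delta>_def by linarith+
  have bound: "cmod (of_real (1 / \<delta> p)) \<le> 1 / (lambda_inf - 1 / 4)" for p
    unfolding norm_of_real using \<delta>[of p] lambda_inf_gt by (simp add: frac_le)
  define v where "v = diag_op (\<lambda>p. of_real (1 / \<delta> p)) prime_recip"
  have v: "ell2_nth v p = of_real (1 / real (nat_of_prime p) / \<delta> p)" for p
    unfolding v_def
    by (subst ell2_nth_diag_op[where d = "\<lambda>p. of_real (1 / \<delta> p)", OF bound])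
      (simp add: ell2_nth_prime_recip)
  have "((\<lambda>p. complex_of_real (secular lambda_inf (nat_of_prime p))) has_sum of_real 1) UNIV"
    by (rule has_sum_of_real[OF has_sum_secular_prime_number])
  moreover have "complex_of_real (secular lambda_inf (nat_of_prime p))
      = cnj (ell2_nth prime_recip p) * ell2_nth v p" for p
    by (simp add: v ell2_nth_prime_recip secular_def \<delta>_def power2_eq_square)
  ultimately have "cinner prime_recip v = 1"
    using has_sum_unique[OF has_sum_cinner[of prime_recip v]] by simp
  then have "lcm_op v = of_real lambda_inf *\<^sub>c v"
  proof (intro ell2_eqI)
    fix p
    assume 1: "cinner prime_recip v = 1"
    have "ell2_nth (lcm_op v) p
        = of_real (prime_diag (nat_of_prime p) * (1 / real (nat_of_prime p) / \<delta> p)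
            + 1 / real (nat_of_prime p))"
      unfolding ell2_nth_lcm_op 1 v ell2_nth_prime_recip by simp
    also have "prime_diag (nat_of_prime p) * (1 / real (nat_of_prime p) / \<delta> p)
            + 1 / real (nat_of_prime p)
        = (prime_diag (nat_of_prime p) + \<delta> p) * (1 / real (nat_of_prime p) / \<delta> p)"
      using \<delta>(2)[of p] by (simp add: add_divide_distrib)
    finally show "ell2_nth (lcm_op v) p = ell2_nth (of_real lambda_inf *\<^sub>c v) p"
      by (simp add: \<delta>_def v)
  qed
  moreover have "v \<noteq> 0"
    using \<open>cinner prime_recip v = 1\<close> by (auto simp: cinner_def)
  ultimately show ?thesis by (rule eigenvalue_in_op_spectrum)
qed

text \<open>For \<open>\<bar>z\<bar> > \<lambda>\<close>, the triangle inequality bounds \<open>\<bar>\<langle>u, (D - z)\<inverse> u\<rangle>\<bar>\<close> by the secular sum at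
  \<open>\<bar>z\<bar>\<close>, which is less than 1 since the secular sum strictly decreases and equals 1 at \<open>\<lambda>\<close>. The
  secular equation thus has no root \<open>z\<close> there, and the Sherman--Morrison formula inverts the
  operator.\<close>

lemma op_spectrum_lcm_op_bound:
  assumes "z \<in> op_spectrum lcm_op"
  shows "cmod z \<le> lambda_inf"
proof (rule ccontr)
  assume "\<not> cmod z \<le> lambda_inf"
  then have z: "lambda_inf < cmod z" by simp
  have low: "cmod z - prime_diag (nat_of_prime p) \<le> cmod (cprime_diag p - z)" for p
    using norm_triangle_ineq2[of z "cprime_diag p"] by (simp add: prime_diag_nonneg norm_minus_commute)
  have low': "cmod z - 1 / 4 \<le> cmod (cprime_diag p - z)" for p
    using low[of p] prime_diag_le_quarter[of "nat_of_prime p"] by linarith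
  have pos: "0 < cmod z - 1 / 4" "0 < cmod z - prime_diag (nat_of_prime p)" for p
    using z lambda_inf_gt prime_diag_le_quarter[of "nat_of_prime p"] by linarith+
  have bound: "cmod (1 / (cprime_diag p - z)) \<le> 1 / (cmod z - 1 / 4)" for p
    unfolding norm_divide using low'[of p] pos by (simp add: frac_le)
  define w where "w = diag_op (\<lambda>p. 1 / (cprime_diag p - z)) prime_recip"
  have w: "ell2_nth w p = ell2_nth prime_recip p / (cprime_diag p - z)" for p
    unfolding w_def by (subst ell2_nth_diag_op[where d = "\<lambda>p. 1 / (cprime_diag p - z)", OF bound]) simp
  let ?s = "\<lambda>p. secular (cmod z) (nat_of_prime p)"
  have less: "?s p < secular lambda_inf (nat_of_prime p)" for p
    by (rule secular_strict_antimono[OF lambda_inf_gt z nat_of_prime_pos])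
  have "?s summable_on UNIV"
    by (rule summable_on_bound[OF has_sum_imp_summable[OF has_sum_secular_prime_number]])
      (use less secular_pos[OF less_trans[OF lambda_inf_gt z] nat_of_prime_pos] in \<open>auto intro: less_imp_le\<close>)
  then have s: "(?s has_sum infsum ?s UNIV) UNIV" by (rule has_sum_infsum)
  have "infsum ?s UNIV < 1"
    by (rule has_sum_strict_mono[OF s has_sum_secular_prime_number less_imp_le[OF less] UNIV_I less])
  moreover have "cmod (cinner prime_recip w) \<le> infsum ?s UNIV"
  proof (rule norm_infsum_le[OF has_sum_cinner s])
    fix p
    have "cmod (cnj (ell2_nth prime_recip p) * ell2_nth w p)
        = (1 / real (nat_of_prime p))\<^sup>2 / cmod (cprime_diag p - z)"
      by (simp add: w ell2_nth_prime_recip norm_mult norm_divide power2_eq_square)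
    also have "\<dots> \<le> ?s p"
      unfolding secular_def
      using low[of p] pos(2)[of p] less_le_trans[OF pos(2)[of p] low[of p]]
      by (intro divide_left_mono mult_pos_pos) simp_all
    finally show "cmod (cnj (ell2_nth prime_recip p) * ell2_nth w p) \<le> ?s p" .
  qed
  ultimately have "1 + cinner prime_recip w \<noteq> 0"
    by (auto simp: add_eq_0_iff)
  then have "z \<notin> op_spectrum lcm_op"
    by (rule resolvent_rank_one_perturbation[OF ell2_nth_lcm_op pos(1) low' w])
  then show False using assms by blast
qed

lemma op_spectral_radius_lcm_op: "op_spectral_radius lcm_op = lambda_inf"
  unfolding op_spectral_radius_def
proof (rule cSup_eq_maximum)
  have "cmod (of_real lambda_inf) = lambda_inf"
    using lambda_inf_gt by simp
  then show "lambda_inf \<in> cmod ` op_spectrum lcm_op"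
    using lambda_inf_in_op_spectrum by (metis imageI)
qed (use op_spectrum_lcm_op_bound in auto)


section \<open>Finite sections\<close>

text \<open>A positive vector \<open>v\<close> with \<open>A v \<le> c v\<close> bounds the eigenvalues of a nonnegative matrix
  \<open>A\<close>: evaluate the eigenvalue equation at an index where \<open>\<bar>w i\<bar> / v i\<close> is maximal.\<close>

lemma cmod_eigenvalue_le_of_subinvariant:
  fixes a :: "'i \<Rightarrow> 'i \<Rightarrow> real" and w :: "'i \<Rightarrow> complex"
  assumes "finite I" and a: "\<And>i j. i \<in> I \<Longrightarrow> j \<in> I \<Longrightarrow> 0 \<le> a i j" and v: "\<And>i. i \<in> I \<Longrightarrow> 0 < v i"
    and sub: "\<And>i. i \<in> I \<Longrightarrow> (\<Sum>j\<in>I. a i j * v j) \<le> c * v i"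
    and ev: "\<And>i. i \<in> I \<Longrightarrow> (\<Sum>j\<in>I. of_real (a i j) * w j) = z * w i"
    and k: "k \<in> I" "w k \<noteq> 0"
  shows "cmod z \<le> c"
proof -
  let ?f = "\<lambda>i. cmod (w i) / v i"
  have "Max (?f ` I) \<in> ?f ` I"
    using \<open>finite I\<close> k by (intro Max_in) auto
  then obtain i where i: "i \<in> I" "?f i = Max (?f ` I)" by force
  have max: "?f j \<le> ?f i" if "j \<in> I" for j
    unfolding i(2) using \<open>finite I\<close> that by (intro Max_ge) auto
  have "0 < ?f i"
    using max[OF k(1)] v[OF k(1)] k(2) by (smt (verit) divide_pos_pos zero_less_norm_iff)
  have "cmod z * cmod (w i) = cmod (\<Sum>j\<in>I. of_real (a i j) * w j)"
    by (simp add: ev[OF i(1)] norm_mult)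
  also have "\<dots> \<le> (\<Sum>j\<in>I. a i j * (?f i * v j))"
  proof (rule sum_norm_le)
    fix j assume j: "j \<in> I"
    have "cmod (w j) \<le> ?f i * v j"
      using max[OF j] v[OF j] by (simp add: pos_divide_le_eq)
    then show "cmod (of_real (a i j) * w j) \<le> a i j * (?f i * v j)"
      unfolding norm_mult norm_of_real abs_of_nonneg[OF a[OF i(1) j]]
      by (rule mult_left_mono[OF _ a[OF i(1) j]])
  qed
  also have "\<dots> = ?f i * (\<Sum>j\<in>I. a i j * v j)"
    unfolding sum_distrib_left by (simp add: mult_ac)
  also have "\<dots> \<le> ?f i * (c * v i)"
    using \<open>0 < ?f i\<close> sub[OF i(1)] by (intro mult_left_mono) auto
  also have "\<dots> = c * cmod (w i)"
    using v[OF i(1)] by simp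
  finally show ?thesis
    using \<open>0 < ?f i\<close> v[OF i(1)] by (simp add: zero_less_divide_iff)
qed

lemma prime_nth_prime: "prime (nth_prime i)"
  unfolding nth_prime_def using enumerate_in_set[OF primes_infinite] by blast

lemma nth_prime_pos: "0 < nth_prime i"
  using prime_gt_0_nat[OF prime_nth_prime] .

lemma bij_nth_prime: "bij_betw nth_prime UNIV {p. prime p}"
  unfolding nth_prime_def by (rule bij_enumerate[OF primes_infinite])

lemma sums_secular_nth_prime: "(\<lambda>i. secular lambda_inf (nth_prime i)) sums 1"
  using has_sum_secular_lambda_inf
  by (intro has_sum_imp_sums) (subst has_sum_reindex_bij_betw[OF bij_nth_prime])

lemma sum_secular_lambda_inf_le: "(\<Sum>i<n. secular lambda_inf (nth_prime i)) \<le> 1"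
  using sum_le_suminf[OF sums_summable[OF sums_secular_nth_prime], of "{..<n}"]
    sums_unique[OF sums_secular_nth_prime] secular_pos[OF lambda_inf_gt nth_prime_pos]
  by (simp add: less_imp_le)

lemma lcm_mat_carrier: "lcm_mat n \<in> carrier_mat n n"
  unfolding lcm_mat_def by simp

lemma lcm_mat_mult_nth:
  assumes "i < n"
  shows "vec_index (lcm_mat n *\<^sub>v vec n w) i
    = (\<Sum>j<n. of_real (lcm_entry (nth_prime i) (nth_prime j)) * w j)"
  using assms unfolding lcm_mat_def
  by (simp add: scalar_prod_def atLeast0LessThan)

lemma eigenvalue_lcm_mat_iff:
  "eigenvalue (lcm_mat n) z \<longleftrightarrow> (\<exists>w. (\<exists>k<n. w k \<noteq> 0) \<and>
     (\<forall>i<n. (\<Sum>j<n. of_real (lcm_entry (nth_prime i) (nth_prime j)) * w j) = z * w i))"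
proof
  assume "eigenvalue (lcm_mat n) z"
  then obtain x where x: "x \<in> carrier_vec n" "x \<noteq> 0\<^sub>v n" "lcm_mat n *\<^sub>v x = z \<cdot>\<^sub>v x"
    unfolding eigenvalue_def eigenvector_def by (auto simp: lcm_mat_def)
  define w where "w = vec_index x"
  have w: "vec n w = x" unfolding w_def using x(1) by auto
  have "\<exists>k<n. w k \<noteq> 0"
    using x(1,2) unfolding w_def by (metis carrier_vecD eq_vecI index_zero_vec)
  moreover have "(\<Sum>j<n. of_real (lcm_entry (nth_prime i) (nth_prime j)) * w j) = z * w i"
    if "i < n" for i
    using lcm_mat_mult_nth[OF that, of w] that x(1,3) unfolding w by (simp add: w_def)
  ultimately show "\<exists>w. (\<exists>k<n. w k \<noteq> 0) \<and>
     (\<forall>i<n. (\<Sum>j<n. of_real (lcm_entry (nth_prime i) (nth_prime j)) * w j) = z * w i)"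
    by (intro exI[of _ w] conjI allI impI)
next
  assume "\<exists>w. (\<exists>k<n. w k \<noteq> 0) \<and>
     (\<forall>i<n. (\<Sum>j<n. of_real (lcm_entry (nth_prime i) (nth_prime j)) * w j) = z * w i)"
  then obtain w where kw: "(\<exists>k<n. w k \<noteq> 0) \<and>
    (\<forall>i<n. (\<Sum>j<n. of_real (lcm_entry (nth_prime i) (nth_prime j)) * w j) = z * w i)"
    by (rule exE) (rule that)
  note k = kw[THEN conjunct1] and w = kw[THEN conjunct2]
  have "lcm_mat n *\<^sub>v vec n w = z \<cdot>\<^sub>v vec n w"
    by (rule eq_vecI) (use w lcm_mat_mult_nth in \<open>auto simp: lcm_mat_def\<close>)
  moreover have "vec n w \<noteq> 0\<^sub>v n"
    using k by (metis index_vec index_zero_vec(1))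
  ultimately show "eigenvalue (lcm_mat n) z"
    unfolding eigenvalue_def eigenvector_def by (intro exI[of _ "vec n w"]) (simp add: lcm_mat_def)
qed

lemma sum_lcm_entry:
  fixes v :: "nat \<Rightarrow> real"
  assumes "i < n"
  shows "(\<Sum>j<n. lcm_entry (nth_prime i) (nth_prime j) * v j)
    = 1 / real (nth_prime i) * (\<Sum>j<n. 1 / real (nth_prime j) * v j)
      + prime_diag (nth_prime i) * v i"
proof -
  have "nth_prime i = nth_prime j \<longleftrightarrow> i = j" for j
    using bij_nth_prime unfolding bij_betw_def inj_def by blast
  then have "lcm_entry (nth_prime i) (nth_prime j) * v j
      = 1 / real (nth_prime i) * (1 / real (nth_prime j) * v j)
        + (if j = i then prime_diag (nth_prime i) * v i else 0)" for j
    by (simp add: lcm_entry_eq prime_nth_prime algebra_simps)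
  then show ?thesis
    using assms by (simp add: sum.distrib sum_divide_distrib mult.commute)
qed

text \<open>The truncation of \<open>(x - D)\<inverse> u\<close> is an eigenvector of a finite section up to a multiple of
  \<open>u\<close>, which vanishes exactly when the partial secular sum equals 1. When that sum is at most 1,
  as for \<^const>\<open>lambda_inf\<close>, the vector is still subinvariant.\<close>

lemma sum_lcm_entry_secular:
  assumes x: "1 / 4 < x" and "i < n"
  defines "v \<equiv> \<lambda>j. 1 / real (nth_prime j) / (x - prime_diag (nth_prime j))"
  shows "(\<Sum>j<n. lcm_entry (nth_prime i) (nth_prime j) * v j)
    = x * v i - (1 - (\<Sum>j<n. secular x (nth_prime j))) / real (nth_prime i)"
proof -
  let ?d = "prime_diag (nth_prime i)"
  have "1 / real (nth_prime j) * v j = secular x (nth_prime j)" for j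
    by (simp add: v_def secular_def power2_eq_square)
  then have "(\<Sum>j<n. lcm_entry (nth_prime i) (nth_prime j) * v j)
      = 1 / real (nth_prime i) * (\<Sum>j<n. secular x (nth_prime j)) + ?d * v i"
    unfolding sum_lcm_entry[OF \<open>i < n\<close>] by simp
  moreover have "x * v i - ?d * v i = 1 / real (nth_prime i)"
    using prime_diag_le_quarter[of "nth_prime i"] x
    unfolding v_def left_diff_distrib[symmetric] by simp
  ultimately show ?thesis by (simp add: diff_divide_distrib)
qed

lemma spectral_radius_lcm_mat_le:
  assumes "0 < n"
  shows "spectral_radius (lcm_mat n) \<le> lambda_inf"
proof -
  obtain z where z: "eigenvalue (lcm_mat n) z" "spectral_radius (lcm_mat n) = cmod z"
    using spectral_radius_mem_max(1)[OF lcm_mat_carrier assms] unfolding spectrum_def by auto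
  obtain w where w: "(\<exists>k<n. w k \<noteq> 0) \<and>
    (\<forall>i<n. (\<Sum>j<n. of_real (lcm_entry (nth_prime i) (nth_prime j)) * w j) = z * w i)"
    using z(1) unfolding eigenvalue_lcm_mat_iff by (rule exE) (rule that)
  then obtain k where k: "k < n" "w k \<noteq> 0"
    by blast
  define v where "v j = 1 / real (nth_prime j) / (lambda_inf - prime_diag (nth_prime j))" for j
  have "cmod z \<le> lambda_inf"
  proof (rule cmod_eigenvalue_le_of_subinvariant[where I = "{..<n}" and v = v and w = w and k = k])
    show "0 < v j" for j
      unfolding v_def using nth_prime_pos[of j] prime_diag_le_quarter[of "nth_prime j"] lambda_inf_gt
      by simp
    show "(\<Sum>j<n. lcm_entry (nth_prime i) (nth_prime j) * v j) \<le> lambda_inf * v i"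
      if "i \<in> {..<n}" for i
      using sum_lcm_entry_secular[OF lambda_inf_gt, of i n, folded v_def] that
        sum_secular_lambda_inf_le[of n] by simp
  qed (use w k in \<open>auto simp: lcm_entry_def\<close>)
  then show ?thesis using z(2) by simp
qed

lemma secular_root_le_spectral_radius:
  assumes "0 < n" and x: "1 / 4 < x" and "(\<Sum>i<n. secular x (nth_prime i)) = 1"
  shows "x \<le> spectral_radius (lcm_mat n)"
proof -
  define v where "v j = 1 / real (nth_prime j) / (x - prime_diag (nth_prime j))" for j
  have "eigenvalue (lcm_mat n) (of_real x)"
    unfolding eigenvalue_lcm_mat_iff
  proof (intro exI[of _ "\<lambda>j. of_real (v j)"] conjI allI impI)
    have "complex_of_real (v 0) \<noteq> 0"
      unfolding v_def using nth_prime_pos[of 0] prime_diag_le_quarter[of "nth_prime 0"] x by simp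
    then show "\<exists>k<n. complex_of_real (v k) \<noteq> 0"
      using assms(1) by blast
  next
    fix i assume "i < n"
    have "(\<Sum>j<n. lcm_entry (nth_prime i) (nth_prime j) * v j) = x * v i"
      using sum_lcm_entry_secular[OF x \<open>i < n\<close>, folded v_def] assms(3) by simp
    then show "(\<Sum>j<n. of_real (lcm_entry (nth_prime i) (nth_prime j)) * of_real (v j))
        = complex_of_real x * of_real (v i)"
      unfolding of_real_mult[symmetric] of_real_sum[symmetric] by simp
  qed
  then have "cmod (of_real x) \<le> spectral_radius (lcm_mat n)"
    by (intro spectral_radius_mem_max(2)[OF lcm_mat_carrier assms(1)] imageI)
      (simp add: spectrum_def)
  then show ?thesis using x by simp
qed

text \<open>For \<open>y < \<lambda>\<close> above \<open>1 / 4\<close>, the first term of the secular sum at \<open>y\<close> exceeds that at \<open>\<lambda>\<close>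
  by a fixed \<open>\<epsilon> > 0\<close>, so a long enough partial sum is at least 1 at \<open>y\<close>, while it is at most 1
  at \<open>\<lambda>\<close>. The intermediate value theorem yields a root in between, and roots of partial secular sums
  are eigenvalues of finite sections.\<close>

lemma ex_spectral_radius_lcm_mat_ge:
  assumes "\<mu> < lambda_inf"
  shows "\<exists>n>0. \<mu> \<le> spectral_radius (lcm_mat n)"
proof -
  obtain y where y: "1 / 4 < y" "\<mu> \<le> y" "y < lambda_inf"
    using dense[of "max \<mu> (1 / 4)" lambda_inf] assms lambda_inf_gt by auto
  define F where "F x n = (\<Sum>i<n. secular x (nth_prime i))" for x n
  define \<epsilon> where "\<epsilon> = secular y (nth_prime 0) - secular lambda_inf (nth_prime 0)"
  have mono: "secular lambda_inf (nth_prime i) < secular y (nth_prime i)" for i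
    by (rule secular_strict_antimono[OF y(1,3) nth_prime_pos])
  have "0 < \<epsilon>" unfolding \<epsilon>_def using mono by simp
  then have "\<forall>\<^sub>F n in sequentially. 1 - \<epsilon> < F lambda_inf n"
    using sums_secular_nth_prime unfolding sums_def F_def by (intro order_tendstoD(1)) auto
  then have "\<forall>\<^sub>F n in sequentially. 1 - \<epsilon> < F lambda_inf n \<and> 0 < n"
    using eventually_gt_at_top[of 0] by (rule eventually_conj)
  then obtain n where n: "1 - \<epsilon> < F lambda_inf n" "0 < n"
    using eventually_happens'[OF sequentially_bot] by blast
  have "\<epsilon> \<le> (\<Sum>i<n. secular y (nth_prime i) - secular lambda_inf (nth_prime i))"
    unfolding \<epsilon>_def
    by (rule member_le_sum[where i = 0 and
          f = "\<lambda>i. secular y (nth_prime i) - secular lambda_inf (nth_prime i)"])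
      (use n mono in \<open>auto intro: less_imp_le\<close>)
  then have "1 \<le> F y n"
    using n(1) unfolding F_def sum_subtractf by linarith
  moreover have "F lambda_inf n \<le> 1"
    unfolding F_def by (rule sum_secular_lambda_inf_le)
  moreover have "continuous_on {y..lambda_inf} (\<lambda>x. F x n)"
    unfolding F_def secular_def
  proof (intro continuous_intros ballI)
    fix x i assume "x \<in> {y..lambda_inf}"
    then show "x - prime_diag (nth_prime i) \<noteq> 0"
      using y(1) prime_diag_le_quarter[of "nth_prime i"] by auto
  qed
  ultimately obtain x where "y \<le> x" "F x n = 1"
    using IVT2'[of "\<lambda>x. F x n" lambda_inf 1 y] y(3) by auto
  then have "x \<le> spectral_radius (lcm_mat n)"
    using secular_root_le_spectral_radius[OF n(2), of x] y(1) unfolding F_def by auto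
  then show ?thesis
    using n(2) y(2) \<open>y \<le> x\<close> by (intro exI[of _ n]) auto
qed


section \<open>Spectral radii of the operator and of its finite sections\<close>

theorem theorem5p4:
  shows "hilbert_schmidt lcm_op \<and> compact_operator lcm_op \<and> self_adjoint lcm_op \<and>
    op_spectral_radius lcm_op = lambda_inf \<and>
    bdd_above ((\<lambda>n. spectral_radius (lcm_mat n)) ` {1..}) \<and>
    (SUP n\<in>{1..}. spectral_radius (lcm_mat n)) = lambda_inf"
proof (intro conjI hilbert_schmidt_lcm_op compact_operator_lcm_op self_adjoint_lcm_op
    op_spectral_radius_lcm_op)
  let ?\<rho> = "\<lambda>n. spectral_radius (lcm_mat n)"
  have le: "?\<rho> n \<le> lambda_inf" if "n \<in> {1..}" for n
    using that by (intro spectral_radius_lcm_mat_le) simp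
  show bdd: "bdd_above (?\<rho> ` {1..})"
    by (rule bdd_aboveI2[OF le])
  show "(SUP n\<in>{1..}. ?\<rho> n) = lambda_inf"
  proof (rule antisym)
    show "(SUP n\<in>{1..}. ?\<rho> n) \<le> lambda_inf"
      by (rule cSUP_least[OF _ le]) auto
    show "lambda_inf \<le> (SUP n\<in>{1..}. ?\<rho> n)"
    proof (rule dense_le)
      fix \<mu> assume "\<mu> < lambda_inf"
      then obtain n where "0 < n" "\<mu> \<le> ?\<rho> n"
        using ex_spectral_radius_lcm_mat_ge by blast
      then show "\<mu> \<le> (SUP n\<in>{1..}. ?\<rho> n)"
        by (intro cSUP_upper2[OF bdd, of n]) auto
    qed
  qed
qed

end
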